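(* Let $m,n$ be positive integers and let $(S,T)$ be a pair of random variables on a common probability space taking values in $\{0,1,\dots,m\}\times\{0,1,\dots,n\}$. Then for all integers $1\le k\le m$ and $1\le l\le n$, $$P(S\ge 1,T\ge 1)\ \ge\ \frac{\binom{m}{k}\binom{n}{l}-\overline{S}_{k,l}}{\binom{m}{k}\binom{n}{l}},$$ where $$\overline{S}_{k,l}=\binom{m}{k}E\left[\binom{n-T}{l}\right]+\binom{n}{l}E\left[\binom{m-S}{k}\right]-E\left[\binom{m-S}{k}\binom{n-T}{l}\right].$$
   Context: For non-negative integers $a,r$, $\binom{a}{r}$ is the usual binomial coefficient, with $\binom{a}{0}=1$ and $\binom{a}{r}=0$ if $r>a$. $E$ denotes expectation. *)

theory Defs
  imports "HOL-Probability.Probability"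
begin

(* The truncated subtractions agree with the integer ones as soon as S <= m and T <= n on space M. *)
definition S_bar ::
  "'a measure \<Rightarrow> nat \<Rightarrow> nat \<Rightarrow> ('a \<Rightarrow> nat) \<Rightarrow> ('a \<Rightarrow> nat) \<Rightarrow> nat \<Rightarrow> nat \<Rightarrow> real" where
  "S_bar M m n S T k l =
     real (m choose k) * prob_space.expectation M (\<lambda>\<omega>. real ((n - T \<omega>) choose l))
   + real (n choose l) * prob_space.expectation M (\<lambda>\<omega>. real ((m - S \<omega>) choose k))
   - prob_space.expectation M (\<lambda>\<omega>. real ((m - S \<omega>) choose k) * real ((n - T \<omega>) choose l))"

end

theory Submission
  imports Defs
begin

text \<open>Writing \<open>X = (m - S choose k)\<close> and \<open>Y = (n - T choose l)\<close>, which attain their maxima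
  \<open>A = (m choose k)\<close> and \<open>B = (n choose l)\<close> at \<open>S = 0\<close> and \<open>T = 0\<close>, the numerator of the bound is
  \<open>E[(A - X) (B - Y)]\<close>. The integrand lies between \<open>0\<close> and \<open>A B\<close> and vanishes unless
  \<open>S \<ge> 1\<close> and \<open>T \<ge> 1\<close>.\<close>

theorem mainTheorem3:
  fixes M :: "'a measure" and S T :: "'a \<Rightarrow> nat" and m n k l :: nat
  assumes "prob_space M"
    and "1 \<le> m" and "1 \<le> n"
    and "(\<lambda>\<omega>. (S \<omega>, T \<omega>)) \<in> measurable M (count_space ({0..m} \<times> {0..n}))"
    and "1 \<le> k" and "k \<le> m" and "1 \<le> l" and "l \<le> n"
  shows "measure M {\<omega> \<in> space M. S \<omega> \<ge> 1 \<and> T \<omega> \<ge> 1}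
    \<ge> (real (m choose k) * real (n choose l) - S_bar M m n S T k l)
        / (real (m choose k) * real (n choose l))"
proof -
  interpret prob_space M by fact
  define A B where "A = real (m choose k)" and "B = real (n choose l)"
  define X Y where "X = (\<lambda>\<omega>. real ((m - S \<omega>) choose k))"
    and "Y = (\<lambda>\<omega>. real ((n - T \<omega>) choose l))"
  define G where "G = {\<omega> \<in> space M. S \<omega> \<ge> 1 \<and> T \<omega> \<ge> 1}"
  \<comment> \<open>Every map out of a count space is measurable, so composing the pair with
    \<open>fst\<close> and \<open>snd\<close> suffices.\<close>
  have [measurable]: "S \<in> measurable M (count_space UNIV)"
    using measurable_compose[OF assms(4), of fst "count_space UNIV"] by simp
  have [measurable]: "T \<in> measurable M (count_space UNIV)"
    using measurable_compose[OF assms(4), of snd "count_space UNIV"] by simp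
  have [measurable]: "X \<in> borel_measurable M" "Y \<in> borel_measurable M" "G \<in> sets M"
    unfolding X_def Y_def G_def by measurable
  \<comment> \<open>Positivity comes from \<open>k \<le> m\<close> and \<open>l \<le> n\<close>; it
    allows the final division by \<open>A * B\<close>.\<close>
  have pos: "A > 0" "B > 0"
    using assms by (simp_all add: A_def B_def)
  \<comment> \<open>Truncated subtraction never exceeds \<open>m\<close> or \<open>n\<close>, so
    these bounds hold even outside \<open>space M\<close>.\<close>
  have X: "0 \<le> X \<omega>" "X \<omega> \<le> A" and Y: "0 \<le> Y \<omega>" "Y \<omega> \<le> B" for \<omega>
    by (auto simp: X_def Y_def A_def B_def intro!: binomial_right_mono)
  have intX: "integrable M X"
    by (rule integrable_const_bound[where B = A]) (use X in auto)
  have intY: "integrable M Y"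
    by (rule integrable_const_bound[where B = B]) (use Y in auto)
  have intXY: "integrable M (\<lambda>\<omega>. X \<omega> * Y \<omega>)"
    by (rule integrable_const_bound[where B = "A * B"]) (use X Y pos in \<open>auto intro!: mult_mono\<close>)
  \<comment> \<open>Linearity of expectation; total mass 1 makes the constant \<open>A * B\<close>
    its own expectation.\<close>
  have "A * B - S_bar M m n S T k l = expectation (\<lambda>\<omega>. A * B - A * Y \<omega> - B * X \<omega> + X \<omega> * Y \<omega>)"
  proof -
    have "S_bar M m n S T k l
        = A * expectation Y + B * expectation X - expectation (\<lambda>\<omega>. X \<omega> * Y \<omega>)"
      by (simp add: S_bar_def A_def B_def X_def Y_def)
    then show ?thesis
      using intX intY intXY by (simp add: prob_space)
  qed
  also have "\<dots> = expectation (\<lambda>\<omega>. (A - X \<omega>) * (B - Y \<omega>))"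
    by (simp add: algebra_simps)
  also have "\<dots> \<le> expectation (\<lambda>\<omega>. A * B * indicator G \<omega>)"
  proof (rule integral_mono)
    show "integrable M (\<lambda>\<omega>. (A - X \<omega>) * (B - Y \<omega>))"
      using intX intY intXY by (simp add: algebra_simps)
    show "integrable M (\<lambda>\<omega>. A * B * indicator G \<omega>)"
      by (intro integrable_mult_right integrable_real_indicator) (auto simp flip: less_top)
    show "(A - X \<omega>) * (B - Y \<omega>) \<le> A * B * indicator G \<omega>" if "\<omega> \<in> space M" for \<omega>
    proof (cases "\<omega> \<in> G")
      case True
      \<comment> \<open>The factors are at most \<open>A\<close> and \<open>B\<close> since
        \<open>X\<close> and \<open>Y\<close> are nonnegative; multiplying these bounds also uses
        \<open>B - Y \<omega> \<ge> 0\<close>.\<close>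
      then show ?thesis
        using X[of \<omega>] Y[of \<omega>] pos by (auto intro!: mult_mono)
    next
      case False
      then have "S \<omega> = 0 \<or> T \<omega> = 0"
        using that by (auto simp: G_def)
      then show ?thesis
        using False by (auto simp: X_def Y_def A_def B_def)
    qed
  qed
  also have "\<dots> = A * B * prob G"
    by simp
  finally have "(A * B - S_bar M m n S T k l) / (A * B) \<le> prob G"
    using pos by (simp add: divide_le_eq mult.commute)
  then show ?thesis
    by (simp add: A_def B_def G_def)
qed

end
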